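(* Let $A$ be a congruent number and let $C_A$ be the curve $y^2=x^3-A^2x$. If $(x_0,y_0)\in\mathbb{Q}^2$ is a rational point on $C_A$ with $y_0\neq 0$, then $(x_0,y_0)$ has infinite order in the group $(C_A(\mathbb{Q}),+)$. In particular, if there exists one rational Pythagorean $A$-triple, then there exist infinitely many rational Pythagorean $A$-triples.
   Context: A positive integer $A$ is called a congruent number if $A$ is the area of a right-angled triangle with three rational sides, i.e. if there exist $a,b,c\in\mathbb{Q}$ with $a^2+b^2=c^2$, $ab\neq 0$ and $\frac{ab}{2}=A$. For a positive integer $A$, a rational Pythagorean $A$-triple is a triple $(a,b,c)$ of non-zero rational numbers (possibly negative) such that $a^2+b^2=c^2$ and $A=\left|\frac{ab}{2}\right|$. $C_A(\mathbb{Q})$ denotes the set of rational points on $C_A: y^2=x^3-A^2x$ together with the point at infinity $\mathscr{O}$. The operation $+$ is the usual chord-and-tangent abelian group law on this elliptic curve, with neutral element $\mathscr{O}$. *)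

theory Defs
  imports Complex_Main "HOL-Algebra.Group"
begin

definition congruent_number :: "nat \<Rightarrow> bool" where
  "congruent_number A \<longleftrightarrow>
     A > 0 \<and> (\<exists>a b c :: rat. a^2 + b^2 = c^2 \<and> a * b \<noteq> 0 \<and> a * b / 2 = of_nat A)"

definition pythagorean_triples :: "nat \<Rightarrow> (rat \<times> rat \<times> rat) set" where
  "pythagorean_triples A =
     {(a, b, c). a \<noteq> 0 \<and> b \<noteq> 0 \<and> c \<noteq> 0 \<and> a^2 + b^2 = c^2 \<and> of_nat A = \<bar>a * b / 2\<bar>}"

datatype point = Infinity | Point rat rat

definition curve_points :: "nat \<Rightarrow> point set" where
  "curve_points A = insert Infinity {Point x y |x y. y^2 = x^3 - (of_nat A)^2 * x}"

text \<open>
  Chord-and-tangent addition. The line through the two points (the tangent, if they coincide)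
  has slope \<open>m\<close>; its third intersection with the curve has x-coordinate \<open>m\<^sup>2 - x1 - x2\<close>, and
  the sum is the reflection of that intersection in the x-axis. On the curve, two affine points
  with the same x-coordinate are either equal or mirror images; mirror images (including a point
  with \<open>y = 0\<close> paired with itself) are joined by a vertical line and add up to \<open>Infinity\<close>.
\<close>

fun point_add :: "nat \<Rightarrow> point \<Rightarrow> point \<Rightarrow> point" where
  "point_add A Infinity Q = Q"
| "point_add A P Infinity = P"
| "point_add A (Point x1 y1) (Point x2 y2) =
     (if x1 = x2 \<and> y1 = - y2 then Infinity
      else let m = (if x1 = x2 then (3 * x1^2 - (of_nat A)^2) / (2 * y1)
                    else (y2 - y1) / (x2 - x1));
               x3 = m^2 - x1 - x2
           in Point x3 (- (y1 + m * (x3 - x1))))"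

definition curve_group :: "nat \<Rightarrow> point monoid" where
  "curve_group A = \<lparr>carrier = curve_points A, mult = point_add A, one = Infinity\<rparr>"

text \<open>
  The group operation is written multiplicatively, so the power \<open>P [^] n\<close> is the n-fold sum
  of \<open>P\<close>. In a group this agrees with \<open>ord P = 0\<close>, see \<open>group.ord_eq_0\<close> in
  \<open>HOL-Algebra.Multiplicative_Group\<close>.
\<close>

definition infinite_order :: "('a, 'b) monoid_scheme \<Rightarrow> 'a \<Rightarrow> bool" where
  "infinite_order G P \<longleftrightarrow> (\<forall>n::nat. n > 0 \<longrightarrow> P [^]\<^bsub>G\<^esub> n \<noteq> \<one>\<^bsub>G\<^esub>)"

end

(*
  Put X = x/A. Doubling a point sends X to (X^2 + 1)^2 / (4 (X^3 - X)), whatever A is. If X is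
  neither 0 nor 1 nor -1, this value has an even denominator, and every further doubling raises
  the exponent of 2 in the denominator by exactly 2. Hence the points 2^j P with j > 0 are pairwise
  distinct. If P had finite order, they would all lie in the finite set of multiples of P, because
  the n-th multiple of 2P is the (2n)-th multiple of P. Of the associative law this requires only
  the identity Q + 2P = (Q + P) + P. Finally, a = (x^2 - A^2)/y, b = 2Ax/y, c = (x^2 + A^2)/y is a
  Pythagorean A-triple from which x = A(a + c)/b is recovered.
*)

theory Submission
  imports Defs "HOL-Computational_Algebra.Primes"
begin

section \<open>Lines meeting the curve\<close>

text \<open>
  The line \<open>y = m x + n\<close> meets the curve in the points with abscissae \<open>x1\<close>, \<open>x2\<close>, \<open>x3\<close>, counted
  with multiplicity: these are Vieta's formulas for \<open>x\<^sup>3 - A\<^sup>2 x - (m x + n)\<^sup>2\<close>. Tangents need no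
  separate treatment in this form.
\<close>

definition line_section :: "nat \<Rightarrow> rat \<Rightarrow> rat \<Rightarrow> rat \<Rightarrow> rat \<Rightarrow> rat \<Rightarrow> bool" where
  "line_section A m n x1 x2 x3 \<longleftrightarrow>
     x1 + x2 + x3 = m^2 \<and> x1 * x2 + x1 * x3 + x2 * x3 = - ((of_nat A)^2) - 2 * m * n \<and>
     x1 * x2 * x3 = n^2"

lemma line_sectionI:
  assumes "x1 + x2 + x3 = m^2" "x1 * x2 + x1 * x3 + x2 * x3 = - ((of_nat A)^2) - 2 * m * n"
    "x1 * x2 * x3 = n^2"
  shows "line_section A m n x1 x2 x3"
  using assms by (simp add: line_section_def)

lemma line_section_rotate: "line_section A m n x1 x2 x3 \<Longrightarrow> line_section A m n x2 x3 x1"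
  unfolding line_section_def by (auto simp: algebra_simps)

lemma line_section_reflect: "line_section A m n x1 x2 x3 \<Longrightarrow> line_section A (- m) (- n) x1 x2 x3"
  unfolding line_section_def by auto

lemma line_section_third_on_curve:
  assumes "line_section A m n x1 x2 x3"
  shows "(m * x3 + n)^2 = x3^3 - (of_nat A)^2 * x3"
  using assms unfolding line_section_def by algebra

text \<open>If \<open>x1 = x2\<close>, the cubic has a double root there, which forces
  \<open>m\<close> to be the tangent slope computed by \<open>point_add\<close>; otherwise
  \<open>m\<close> is the chord slope.\<close>

lemma point_add_line_section:
  assumes "A > 0" and sec: "line_section A m n x1 x2 x3"
  shows "point_add A (Point x1 (m * x1 + n)) (Point x2 (m * x2 + n)) = Point x3 (- (m * x3 + n))"
proof -
  define y where "y = m * x1 + n"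
  have sum: "x1 + x2 + x3 = m^2" using sec by (simp add: line_section_def)
  have tangent: "3 * x1^2 - (of_nat A)^2 = 2 * y * m" if "x1 = x2"
    using sec that unfolding line_section_def y_def by algebra
  have cubic: "y^2 = x1^3 - (of_nat A)^2 * x1"
    unfolding y_def
    using line_section_third_on_curve[OF line_section_rotate[OF sec]] .
  \<comment> \<open>A double root at ordinate 0 would be a singular point:
    \<open>3 * x1^2 = A^2\<close> excludes both \<open>x1 = 0\<close> and \<open>x1^2 = A^2\<close>
    when \<open>A > 0\<close>.\<close>
  have y: "y \<noteq> 0" if "x1 = x2"
  proof
    assume "y = 0"
    then have "3 * x1^2 = (of_nat A)^2" "x1 * (x1^2 - (of_nat A)^2) = 0"
      using tangent[OF that] cubic by (auto simp: power2_eq_square power3_eq_cube algebra_simps)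
    then have "(of_nat A :: rat) = 0" by auto
    with \<open>A > 0\<close> show False by simp
  qed
  have slope: "(if x1 = x2 then (3 * x1^2 - (of_nat A)^2) / (2 * (m * x1 + n))
      else ((m * x2 + n) - (m * x1 + n)) / (x2 - x1)) = m"
    using tangent y by (auto simp: y_def field_simps)
  have "(x1 = x2 \<and> m * x1 + n = - (m * x2 + n)) = False"
    using y by (auto simp: y_def)
  moreover have "m^2 - x1 - x2 = x3" using sum by simp
  moreover have "m * x1 + n + m * (x3 - x1) = m * x3 + n" by algebra
  ultimately show ?thesis by (simp only: point_add.simps slope Let_def if_False)
qed

lemma point_add_eqI:
  assumes "A > 0" "line_section A m n x1 x2 x3"
    and "y1 = m * x1 + n" "y2 = m * x2 + n" "y3 = - (m * x3 + n)"
  shows "point_add A (Point x1 y1) (Point x2 y2) = Point x3 y3"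
  unfolding assms(3-) using assms(1,2) by (rule point_add_line_section)

lemma line_section_exists:
  assumes c1: "y1^2 = x1^3 - (of_nat A)^2 * x1" and c2: "y2^2 = x2^3 - (of_nat A)^2 * x2"
    and ne: "\<not> (x1 = x2 \<and> y1 = - y2)"
  obtains m n x3 where "line_section A m n x1 x2 x3" "y1 = m * x1 + n" "y2 = m * x2 + n"
proof (cases "x1 = x2")
  case True
  define m where "m = (3 * x1^2 - (of_nat A)^2) / (2 * y1)"
  have "y1^2 = y2^2" using c1 c2 True by simp
  then have y: "y1 = y2" "y1 \<noteq> 0" using ne True by (auto simp: power2_eq_iff)
  have m: "2 * y1 * m = 3 * x1^2 - (of_nat A)^2" using y by (simp add: m_def)
  have "line_section A m (y1 - m * x1) x1 x2 (m^2 - x1 - x2)"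
    unfolding True[symmetric] by (rule line_sectionI, algebra, (use m c1 in algebra)+)
  then show ?thesis by (rule that) (use y True in simp_all)
next
  case False
  define m where "m = (y2 - y1) / (x2 - x1)"
  have m: "m * (x2 - x1) = y2 - y1" using False by (simp add: m_def)
  \<comment> \<open>\<open>X^3 - A^2 X - (m X + n)^2\<close> minus
    \<open>(X - x1) (X - x2) (X - x3)\<close> is linear in \<open>X\<close> and vanishes at
    \<open>x1\<close> and \<open>x2\<close>. Subtracting the two values leaves, up to sign,
    \<open>x2 - x1\<close> times its leading coefficient.\<close>
  have "(x2 - x1) * (x1 * x2 + x1 * (m^2 - x1 - x2) + x2 * (m^2 - x1 - x2)
      - (- ((of_nat A)^2) - 2 * m * (y1 - m * x1))) = 0"
    using m c1 c2 by algebra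
  then have e2: "x1 * x2 + x1 * (m^2 - x1 - x2) + x2 * (m^2 - x1 - x2)
      = - ((of_nat A)^2) - 2 * m * (y1 - m * x1)"
    using False by simp
  then have "x1 * x2 * (m^2 - x1 - x2) = (y1 - m * x1)^2"
    using c1 by algebra
  with e2 have "line_section A m (y1 - m * x1) x1 x2 (m^2 - x1 - x2)"
    unfolding line_section_def by simp
  then show ?thesis by (rule that) (use m in \<open>simp_all add: algebra_simps\<close>)
qed

section \<open>Closure and commutativity of the addition\<close>

lemma Point_in_curve_iff:
  "Point x y \<in> curve_points A \<longleftrightarrow> y^2 = x^3 - (of_nat A)^2 * x"
  by (auto simp: curve_points_def)

lemma point_add_closed:
  assumes "A > 0" "P \<in> curve_points A" "Q \<in> curve_points A"
  shows "point_add A P Q \<in> curve_points A"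
proof (cases "P = Infinity \<or> Q = Infinity")
  case True
  then show ?thesis using assms by (cases P) auto
next
  case False
  then obtain x1 y1 x2 y2 where PQ: "P = Point x1 y1" "Q = Point x2 y2"
    by (meson point.exhaust)
  show ?thesis
  proof (cases "x1 = x2 \<and> y1 = - y2")
    case True
    then show ?thesis by (simp add: PQ curve_points_def)
  next
    case False
    have "y1^2 = x1^3 - (of_nat A)^2 * x1" "y2^2 = x2^3 - (of_nat A)^2 * x2"
      using assms PQ by (simp_all add: Point_in_curve_iff)
    then obtain m n x3 where sec: "line_section A m n x1 x2 x3" "y1 = m * x1 + n" "y2 = m * x2 + n"
      using False by (rule line_section_exists)
    have "point_add A P Q = Point x3 (- (m * x3 + n))"
      unfolding PQ sec(2,3) by (rule point_add_line_section[OF \<open>A > 0\<close> sec(1)])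
    then show ?thesis
      using line_section_third_on_curve[OF sec(1)]
      by (simp add: Point_in_curve_iff del: minus_add_distrib)
  qed
qed

lemma point_add_commute:
  assumes "A > 0" "P \<in> curve_points A" "Q \<in> curve_points A"
  shows "point_add A P Q = point_add A Q P"
proof (cases "P = Infinity \<or> Q = Infinity")
  case True
  then show ?thesis by (cases P; cases Q) auto
next
  case False
  then obtain x1 y1 x2 y2 where PQ: "P = Point x1 y1" "Q = Point x2 y2"
    by (meson point.exhaust)
  show ?thesis
  proof (cases "x1 = x2 \<and> y1 = - y2")
    case True
    then show ?thesis by (simp add: PQ)
  next
    case False
    have "y1^2 = x1^3 - (of_nat A)^2 * x1" "y2^2 = x2^3 - (of_nat A)^2 * x2"
      using assms PQ by (simp_all add: Point_in_curve_iff)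
    then obtain m n x3 where sec: "line_section A m n x1 x2 x3" "y1 = m * x1 + n" "y2 = m * x2 + n"
      using False by (rule line_section_exists)
    then have swap: "line_section A m n x2 x1 x3" by (auto simp: line_section_def algebra_simps)
    then show ?thesis
      unfolding PQ sec(2,3)
      using point_add_line_section[OF \<open>A > 0\<close> sec(1)] point_add_line_section[OF \<open>A > 0\<close> swap] by simp
  qed
qed

section \<open>Associativity when the same point is added twice\<close>

text \<open>
  In the main case, let \<open>t\<close> be the slope of the line \<open>PQ\<close>, \<open>m\<close> the slope of the tangent at \<open>P\<close>, and
  \<open>s = (xQ - x) / (m - t)\<close>. Then the line through \<open>Q + P\<close> and \<open>P\<close> has slope \<open>-(t + s)\<close>, the line
  through \<open>Q\<close> and \<open>2P\<close> has slope \<open>-(m + s)\<close>, and both have third intersection \<open>(xS, yS)\<close>.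
  Stating this with \<open>line_section\<close> covers the coincidences \<open>Q = 2P\<close> and \<open>Q + P = P\<close> as well.
\<close>

lemma point_add_double:
  assumes A: "A > 0" and P: "Point x y \<in> curve_points A" "y \<noteq> 0" and Q: "Q \<in> curve_points A"
  shows "point_add A Q (point_add A (Point x y) (Point x y)) =
         point_add A (point_add A Q (Point x y)) (Point x y)"
proof -
  have cP: "y^2 = x^3 - (of_nat A)^2 * x" using P by (simp add: Point_in_curve_iff)
  define m where "m = (3 * x^2 - (of_nat A)^2) / (2 * y)"
  have m: "2 * y * m = 3 * x^2 - (of_nat A)^2" using P by (simp add: m_def)
  define w where "w = m^2 - 2 * x"
  define z where "z = y + m * (w - x)"
  have tan: "line_section A m (y - m * x) x x w"
    unfolding w_def by (rule line_sectionI, algebra, (use m cP in algebra)+)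
  have dbl: "point_add A (Point x y) (Point x y) = Point w (- z)"
    using point_add_line_section[OF A tan] by (simp add: z_def algebra_simps)
  \<comment> \<open>\<open>Point w z\<close> is -2P. For Q among P, -P and -2P, the line PQ is
    vertical or tangent at P, so these values are separated from the main case.\<close>
  consider "Q = Infinity" | "Q = Point x y" | "Q = Point x (- y)" | "Q = Point w z"
    | xQ yQ where "Q = Point xQ yQ" "xQ \<noteq> x" "Q \<noteq> Point w z"
  proof (cases Q)
    case (Point xQ yQ)
    have "yQ^2 = y^2" if "xQ = x" using Q that cP by (simp add: Point Point_in_curve_iff)
    then show ?thesis using that Point by (auto simp: power2_eq_iff)
  qed
  then show ?thesis
  proof cases
    case 1
    then show ?thesis by simp
  next
    case 2
    then show ?thesis
      using point_add_commute[OF A Q point_add_closed[OF A P(1) P(1)]] by simp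
  next
    case 3
    have "point_add A (Point x (- y)) (Point w (- z)) = Point x y"
      by (rule point_add_eqI[OF A line_section_reflect[OF line_section_rotate[OF tan]]])
        (simp_all add: z_def algebra_simps)
    with 3 show ?thesis unfolding dbl by simp
  next
    case 4
    have "point_add A (Point w z) (Point x y) = Point x (- y)"
      by (rule point_add_eqI[OF A line_section_rotate[OF line_section_rotate[OF tan]]])
        (simp_all add: z_def algebra_simps)
    with 4 show ?thesis unfolding dbl by simp
  next
    case (5 xQ yQ)
    have cQ: "yQ^2 = xQ^3 - (of_nat A)^2 * xQ" using Q 5 by (simp add: Point_in_curve_iff)
    define u where "u = xQ - x"
    define t where "t = (yQ - y) / u"
    have u: "u \<noteq> 0" "xQ = x + u" "yQ = y + t * u" using 5 by (auto simp: u_def t_def)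
    \<comment> \<open>This is the difference of the curve equations of Q and P, with
      \<open>3 * x^2 - A^2\<close> replaced by \<open>2 * y * m\<close>.\<close>
    have "u * (t^2 * u + 2 * y * t - u^2 - 3 * x * u - 2 * y * m) = 0"
      using cP cQ[unfolded u(2,3)] m by algebra
    then have rel: "t^2 * u + 2 * y * t = u^2 + 3 * x * u + 2 * y * m" using u by simp
    \<comment> \<open>If the chord were the tangent at P, its remaining intersection Q would be
      -2P.\<close>
    have "t \<noteq> m"
    proof
      assume "t = m"
      have "u * (m^2 - u - 3 * x) = 0" using rel[unfolded \<open>t = m\<close>] by algebra
      then have "u = w - x" using u by (simp add: w_def)
      then have "Q = Point w z" using 5 u \<open>t = m\<close> by (simp add: z_def)
      with 5 show False by simp
    qed
    define k where "k = m - t"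
    define s where "s = u / k"
    have k: "k \<noteq> 0" "m = t + k" "u = k * s"
      using \<open>t \<noteq> m\<close> by (auto simp: k_def s_def)
    \<comment> \<open>Under \<open>m = t + k\<close> and \<open>u = k * s\<close>, the relation
      \<open>rel\<close> acquires a factor \<open>k\<close>. Cancelling it expresses
      \<open>y\<close> through \<open>t\<close>, \<open>k\<close>, \<open>s\<close>,
      \<open>x\<close>, and what remains is polynomial algebra.\<close>
    have "k * (2 * y - s * (t^2 - k * s - 3 * x)) = 0" using rel k(2,3) by algebra
    then have y2: "2 * y = s * (t^2 - k * s - 3 * x)" using k by simp
    \<comment> \<open>Like \<open>u\<close>, \<open>v\<close> is an offset from \<open>x\<close>:
      the sum Q + P has abscissa \<open>x + v\<close>.\<close>
    define v where "v = t^2 - 3 * x - u"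
    define xS where "xS = x + s * (m + t + s)"
    define yS where "yS = y - (t + s) * (xS - x)"
    have sec1: "line_section A t (y - t * x) (x + u) x (x + v)"
      unfolding v_def k(3) by (rule line_sectionI, algebra, (use m cP y2 k(2) in algebra)+)
    have sec2: "line_section A (- (t + s)) (y + (t + s) * x) (x + v) x xS"
      unfolding v_def xS_def k(3)
      by (rule line_sectionI, use k(2) in algebra, (use m cP y2 k(2) in algebra)+)
    have sec3: "line_section A (- (m + s)) (yQ + (m + s) * xQ) xQ w xS"
      unfolding w_def xS_def u(2,3) k(3)
      by (rule line_sectionI, use k(2) in algebra, (use m cP y2 k(2) in algebra)+)
    have 1: "point_add A Q (Point x y) = Point (x + v) (- (y + t * v))"
      unfolding 5(1) u(2,3) by (rule point_add_eqI[OF A sec1]) algebra+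
    have "- (y + t * v) = - (t + s) * (x + v) + (y + (t + s) * x)"
      unfolding v_def k(3) using y2 k(2) by algebra
    then have 2: "point_add A (Point (x + v) (- (y + t * v))) (Point x y) = Point xS (- yS)"
      by (rule point_add_eqI[OF A sec2]) (unfold yS_def, algebra+)
    have "yQ = - (m + s) * xQ + (yQ + (m + s) * xQ)" by algebra
    moreover have "- z = - (m + s) * w + (yQ + (m + s) * xQ)"
      unfolding z_def w_def u(2,3) k(3) using y2 k(2) by algebra
    moreover have "- yS = - (- (m + s) * xS + (yQ + (m + s) * xQ))"
      unfolding yS_def xS_def u(2,3) k(3) using y2 k(2) by algebra
    ultimately have "point_add A Q (Point w (- z)) = Point xS (- yS)"
      unfolding 5(1) by (rule point_add_eqI[OF A sec3])
    with 1 2 show ?thesis by (simp add: dbl del: point_add.simps)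
  qed
qed

section \<open>Multiples of a point\<close>

lemma curve_group_simps [simp]:
  "carrier (curve_group A) = curve_points A"
  "P \<otimes>\<^bsub>curve_group A\<^esub> Q = point_add A P Q"
  "\<one>\<^bsub>curve_group A\<^esub> = Infinity"
  by (simp_all add: curve_group_def)

lemma curve_group_pow_closed:
  assumes "A > 0" "P \<in> curve_points A"
  shows "P [^]\<^bsub>curve_group A\<^esub> (n::nat) \<in> curve_points A"
proof (induction n)
  case 0
  then show ?case by (simp add: curve_points_def)
next
  case (Suc n)
  then show ?case using assms point_add_closed by (simp)
qed

text \<open>Powers grow by a factor on the right, so the induction step is
  \<open>point_add_double\<close> at Q = 2nP.\<close>

lemma curve_group_pow_double:
  assumes "A > 0" "Point x y \<in> curve_points A" "y \<noteq> 0"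
  shows "point_add A (Point x y) (Point x y) [^]\<^bsub>curve_group A\<^esub> (n::nat)
    = Point x y [^]\<^bsub>curve_group A\<^esub> (2 * n)"
proof (induction n)
  case 0
  then show ?case by (simp)
next
  case (Suc n)
  then show ?case
    using point_add_double[OF assms curve_group_pow_closed[OF assms(1,2)]]
    by (simp del: point_add.simps)
qed

text \<open>Once nP is the neutral element, adding P repeatedly runs through the same values again,
  with period \<open>n\<close>.\<close>

lemma finite_range_curve_group_pow:
  assumes "n > 0" "P [^]\<^bsub>curve_group A\<^esub> (n::nat) = Infinity"
  shows "finite (range (\<lambda>k::nat. P [^]\<^bsub>curve_group A\<^esub> k))"
proof -
  let ?f = "\<lambda>k::nat. P [^]\<^bsub>curve_group A\<^esub> k"
  have "?f (n + m) = ?f m" for m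
    by (induction m) (simp_all add: assms)
  then have shift: "?f (m + n) = ?f m" for m by (metis add.commute)
  have "?f k \<in> ?f ` {..<n}" for k
  proof (induction k rule: less_induct)
    case (less k)
    show ?case
    proof (cases "k < n")
      case False
      then have "?f k = ?f (k - n)" using shift[of "k - n"] by simp
      then show ?thesis using less[of "k - n"] False \<open>n > 0\<close> by simp
    qed auto
  qed
  then have "range ?f \<subseteq> ?f ` {..<n}" by blast
  then show ?thesis by (rule finite_subset) simp
qed

section \<open>Powers of 2 in denominators\<close>

text \<open>The 2-adic valuation of \<open>X\<close> is \<open>- e\<close>; \<open>p\<close> and
  \<open>q\<close> may share odd factors.\<close>

definition denominator_order2 :: "nat \<Rightarrow> rat \<Rightarrow> bool" where
  "denominator_order2 e X \<longleftrightarrow>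
     (\<exists>p q :: int. odd p \<and> odd q \<and> X = of_int p / (2 ^ e * of_int q))"

lemma denominator_order2_unique:
  assumes "denominator_order2 e X" "denominator_order2 f X"
  shows "e = f"
proof -
  have "\<not> e < f" if dX: "denominator_order2 e X" "denominator_order2 f X" for e f
  proof
    assume "e < f"
    obtain p q p' q' :: int where *: "odd p" "odd q" "odd p'" "odd q'"
        and "X = of_int p / (2 ^ e * of_int q)" "X = of_int p' / (2 ^ f * of_int q')"
      using dX unfolding denominator_order2_def by blast
    then have "(of_int p :: rat) / (2 ^ e * of_int q) = of_int p' / (2 ^ f * of_int q')" by simp
    moreover have "q \<noteq> 0" "q' \<noteq> 0" using * by auto
    ultimately have "of_int (p * (2 ^ f * q')) = (of_int (p' * (2 ^ e * q)) :: rat)"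
      by (simp add: frac_eq_eq)
    then have "p * (2 ^ f * q') = p' * (2 ^ e * q)" by (simp only: of_int_eq_iff)
    moreover have "(2::int) ^ f = 2 ^ e * 2 ^ (f - e)" using \<open>e < f\<close> by (simp flip: power_add)
    ultimately have "2 ^ e * (p * 2 ^ (f - e) * q') = 2 ^ e * (p' * q)" by (simp add: mult_ac)
    then have "p * 2 ^ (f - e) * q' = p' * q" by simp
    moreover have "even (p * 2 ^ (f - e) * q')" using \<open>e < f\<close> by simp
    ultimately show False using * by simp
  qed
  then show ?thesis using assms by (meson linorder_neqE_nat)
qed

text \<open>Serves to exclude 0, 1 and -1, the values of x/A at points with ordinate 0.\<close>

lemma denominator_order2_not_int:
  assumes "denominator_order2 e X" "e \<ge> 1"
  shows "X \<noteq> of_int i"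
proof
  assume "X = of_int i"
  with assms obtain p q :: int where "odd p" "odd q" "of_int i = (of_int p :: rat) / (2 ^ e * of_int q)"
    unfolding denominator_order2_def by metis
  moreover from this have "q \<noteq> 0" by auto
  ultimately have "of_int (i * (2 ^ e * q)) = (of_int p :: rat)" by (simp add: field_simps)
  then have "i * (2 ^ e * q) = p" by (simp only: of_int_eq_iff)
  with \<open>odd p\<close> \<open>e \<ge> 1\<close> show False by auto
qed

definition double_x :: "rat \<Rightarrow> rat" where
  "double_x X = (X^2 + 1)^2 / (4 * (X^3 - X))"

lemma double_x_fraction:
  assumes "q \<noteq> 0"
  shows "double_x (p / q) = (p^2 + q^2)^2 / (4 * p * q * (p^2 - q^2))"
proof -
  have "(p / q)^2 + 1 = (p^2 + q^2) / q^2" using assms by (simp add: field_simps)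
  moreover have "4 * ((p / q)^3 - p / q) = 4 * p * q * (p^2 - q^2) / (q^2)^2"
    using assms by (simp add: field_simps power2_eq_square power3_eq_cube)
  ultimately show ?thesis
    using assms unfolding double_x_def by (simp add: power_divide)
qed

text \<open>For \<open>X = p / r\<close> with \<open>r = 2 ^ e * q\<close> even, both
  \<open>p^2 + r^2\<close> and \<open>p^2 - r^2\<close> are odd, so the denominator
  \<open>4 * p * r * (p^2 - r^2)\<close> contains exactly \<open>2 ^ (e + 2)\<close>.\<close>

lemma denominator_order2_double_x:
  assumes "denominator_order2 e X" "e \<ge> 1"
  shows "denominator_order2 (e + 2) (double_x X)"
proof -
  obtain p q :: int where pq: "odd p" "odd q" "X = of_int p / (2 ^ e * of_int q)"
    using assms unfolding denominator_order2_def by blast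
  define r where "r = 2 ^ e * q"
  have r: "even r" "r \<noteq> 0" using \<open>e \<ge> 1\<close> pq by (auto simp: r_def)
  have X: "X = of_int p / of_int r" by (simp add: pq r_def)
  have "double_x X = of_int ((p^2 + r^2)^2) / of_int (4 * p * r * (p^2 - r^2))"
    unfolding X using r by (subst double_x_fraction) simp_all
  also have "4 * p * r * (p^2 - r^2) = 2 ^ (e + 2) * (p * q * (p^2 - r^2))"
    by (simp add: r_def)
  finally show ?thesis
    unfolding denominator_order2_def using pq r
    by (intro exI[of _ "(p^2 + r^2)^2"] exI[of _ "p * q * (p^2 - r^2)"]) simp
qed

lemma denominator_order2_of_fraction:
  assumes "odd p" "even q" "q \<noteq> 0"
  obtains e where "e \<ge> 1" "denominator_order2 e (of_int p / of_int q)"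
proof -
  obtain r where r: "q = 2 ^ multiplicity 2 q * r" "odd r"
    using multiplicity_decompose'[of q 2] assms by auto
  have "multiplicity 2 q \<noteq> 0" using r assms by (metis mult_1 power_0)
  moreover have "(of_int q :: rat) = 2 ^ multiplicity 2 q * of_int r"
    by (subst r(1)) simp
  ultimately show ?thesis
    using that[of "multiplicity 2 q"] assms r unfolding denominator_order2_def by force
qed

text \<open>Take \<open>X = p / q\<close> in lowest terms. If \<open>p\<close> and \<open>q\<close>
  differ in parity, the numerator is odd and the denominator a multiple of 4. If both are odd,
  \<open>p^2 + q^2\<close> is twice an odd number; the factor 4 cancels, and
  \<open>p^2 - q^2\<close> keeps the denominator even.\<close>

lemma denominator_order2_double_x_initial:
  assumes "X \<noteq> 0" "X^2 \<noteq> 1"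
  obtains e where "e \<ge> 1" "denominator_order2 e (double_x X)"
proof -
  obtain p q :: int where pq: "X = of_int p / of_int q" "q > 0" "coprime p q"
    by (cases X) (auto simp: Fract_of_int_quotient)
  have dX: "double_x X = of_int ((p^2 + q^2)^2) / of_int (4 * p * q * (p^2 - q^2))"
    unfolding pq(1) using pq by (subst double_x_fraction) simp_all
  have "p^2 \<noteq> q^2"
  proof
    assume "p^2 = q^2"
    then have "(of_int p :: rat)^2 = of_int q^2" by (metis of_int_power)
    then have "X^2 = 1" using pq by (simp add: power_divide)
    with assms show False by simp
  qed
  then have nz: "4 * p * q * (p^2 - q^2) \<noteq> 0" "p * q * (p^2 - q^2) \<noteq> 0"
    using assms pq by auto
  show ?thesis
  proof (cases "odd p \<and> odd q")
    case False
    then have "odd ((p^2 + q^2)^2)"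
      using pq by (auto simp: coprime_common_divisor)
    then show ?thesis
      using denominator_order2_of_fraction nz that unfolding dX by (metis dvd_mult2 even_numeral)
  next
    case True
    then obtain a b where ab: "p = 2 * a + 1" "q = 2 * b + 1" by (auto elim!: oddE)
    define c where "c = 2 * (a^2 + a + b^2 + b) + 1"
    have c: "p^2 + q^2 = 2 * c" by (simp add: c_def ab power2_eq_square algebra_simps)
    have "double_x X = of_int (c^2) / of_int (p * q * (p^2 - q^2))"
      unfolding dX c by (simp add: power_mult_distrib mult.assoc)
    moreover have "odd (c^2)" "even (p * q * (p^2 - q^2))" using True by (auto simp: c_def)
    ultimately show ?thesis using denominator_order2_of_fraction nz(2) that by metis
  qed
qed

section \<open>Repeated doubling on the curve and infinite order\<close>

lemma curve_double:
  assumes A: "A > 0" and P: "Point x y \<in> curve_points A" "y \<noteq> 0"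
  obtains x' y' where "point_add A (Point x y) (Point x y) = Point x' y'"
    "Point x' y' \<in> curve_points A" "x' / of_nat A = double_x (x / of_nat A)"
proof -
  define a :: rat where "a = of_nat A"
  have a: "a \<noteq> 0" using A by (simp add: a_def)
  have c: "y^2 = x^3 - a^2 * x" using P by (simp add: Point_in_curve_iff a_def)
  then have nz: "x^3 - a^2 * x \<noteq> 0" using P by auto
  define m where "m = (3 * x^2 - a^2) / (2 * y)"
  define x' where "x' = m^2 - x - x"
  have dbl: "point_add A (Point x y) (Point x y) = Point x' (- (y + m * (x' - x)))"
    using P by (simp add: m_def x'_def a_def Let_def)
  have "x' * (4 * y^2) = (3 * x^2 - a^2)^2 - 8 * x * y^2"
    using P by (simp add: x'_def m_def power_divide field_simps)
  \<comment> \<open>Eliminating \<open>y^2\<close> by the curve equation makes the numerator of the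
    tangent formula a perfect square.\<close>
  also have "\<dots> = (x^2 + a^2)^2" unfolding c by algebra
  finally have x': "x' * (4 * (x^3 - a^2 * x)) = (x^2 + a^2)^2" by (simp add: c)
  have "double_x (x / a) = (x^2 + a^2)^2 / (4 * x * a * (x^2 - a^2))"
    using a by (rule double_x_fraction)
  also have "4 * x * a * (x^2 - a^2) = a * (4 * (x^3 - a^2 * x))" by algebra
  also have "(x^2 + a^2)^2 / (a * (4 * (x^3 - a^2 * x))) = x' / a"
    unfolding x'[symmetric] using a nz by simp
  finally show ?thesis
    using that dbl point_add_closed[OF A P(1) P(1)] by (simp add: a_def)
qed

text \<open>Ordinate 0 would make x one of 0, A, -A. Excluding it ensures that the next doubling
  does not reach \<open>Infinity\<close>.\<close>

lemma curve_ordinate_nonzero: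
  assumes "A > 0" "Point x y \<in> curve_points A" "denominator_order2 e (x / of_nat A)" "e \<ge> 1"
  shows "y \<noteq> 0"
proof
  assume "y = 0"
  moreover have "x * (x - of_nat A) * (x + of_nat A) = x^3 - (of_nat A)^2 * x" by algebra
  ultimately have "x * (x - of_nat A) * (x + of_nat A) = 0"
    using assms(2) by (simp add: Point_in_curve_iff)
  then have "x / of_nat A = of_int 0 \<or> x / of_nat A = of_int 1 \<or> x / of_nat A = of_int (- 1)"
    using \<open>A > 0\<close> by (auto simp: add_eq_0_iff2)
  then show False using denominator_order2_not_int[OF assms(3,4)] by blast
qed

lemma pow_two_power_denominator:
  assumes A: "A > 0" and "Point x y \<in> curve_points A" "e \<ge> 1" "denominator_order2 e (x / of_nat A)"
  shows "\<exists>x' y'. Point x' y' = Point x y [^]\<^bsub>curve_group A\<^esub> ((2::nat) ^ j)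
      \<and> Point x' y' \<in> curve_points A \<and> y' \<noteq> 0
      \<and> denominator_order2 (e + 2 * j) (x' / of_nat A)"
  using assms(2-)
\<comment> \<open>The point and \<open>e\<close> vary because the hypothesis is applied to the
  double of the point: its \<open>2 ^ j\<close>-fold is the \<open>2 ^ Suc j\<close>-fold of the
  original one.\<close>
proof (induction j arbitrary: x y e)
  case 0
  then show ?case using curve_ordinate_nonzero[OF A] by force
next
  case (Suc j)
  then have y: "y \<noteq> 0" using curve_ordinate_nonzero[OF A] by blast
  obtain x' y' where dbl: "point_add A (Point x y) (Point x y) = Point x' y'"
    "Point x' y' \<in> curve_points A" "x' / of_nat A = double_x (x / of_nat A)"
    using curve_double[OF A Suc.prems(1) y] .
  have "denominator_order2 (e + 2) (x' / of_nat A)"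
    using denominator_order2_double_x Suc.prems dbl by simp
  moreover have "Point x' y' [^]\<^bsub>curve_group A\<^esub> ((2::nat) ^ j)
      = Point x y [^]\<^bsub>curve_group A\<^esub> ((2::nat) ^ Suc j)"
    using curve_group_pow_double[OF A Suc.prems(1) y] dbl(1) by simp
  ultimately show ?case using Suc.IH[OF dbl(2), of "e + 2"] by simp
qed

text \<open>Counting abscissae serves both infinite order and the triples;
  \<open>y' \<noteq> 0\<close> is recorded because the triples divide by \<open>y'\<close>.\<close>

lemma infinite_pow_abscissae:
  assumes A: "A > 0" and P: "Point x y \<in> curve_points A" "y \<noteq> 0"
  shows "infinite {x'. \<exists>y' k. Point x' y' = Point x y [^]\<^bsub>curve_group A\<^esub> (k::nat)
    \<and> Point x' y' \<in> curve_points A \<and> y' \<noteq> 0}" (is "infinite ?S")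
proof -
  let ?X = "x / of_nat A"
  have "x^3 - (of_nat A)^2 * x = x * (x - of_nat A) * (x + of_nat A)" by algebra
  then have "x \<noteq> 0" "x \<noteq> of_nat A" "x \<noteq> - of_nat A"
    using P by (auto simp: Point_in_curve_iff)
  then have "?X \<noteq> 0" "?X^2 \<noteq> 1"
    using A by (auto simp: power_divide power2_eq_iff)
  then obtain e where e: "e \<ge> 1" "denominator_order2 e (double_x ?X)"
    by (rule denominator_order2_double_x_initial)
  obtain u v where dbl: "point_add A (Point x y) (Point x y) = Point u v"
    "Point u v \<in> curve_points A" "u / of_nat A = double_x ?X"
    using curve_double[OF A P] .
  \<comment> \<open>The extra factor 2 is the initial doubling, after which the denominator is known
    to be even.\<close>
  have "\<exists>x' y'. Point x' y' = Point x y [^]\<^bsub>curve_group A\<^esub> ((2::nat) * 2 ^ j)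
      \<and> Point x' y' \<in> curve_points A \<and> y' \<noteq> 0
      \<and> denominator_order2 (e + 2 * j) (x' / of_nat A)" for j
    using pow_two_power_denominator[OF A dbl(2) e(1)] e(2) dbl(3)
      curve_group_pow_double[OF A P] dbl(1)
    by (simp del: point_add.simps)
  then obtain X Y where XY: "\<And>j. Point (X j) (Y j) = Point x y [^]\<^bsub>curve_group A\<^esub> ((2::nat) * 2 ^ j)
      \<and> Point (X j) (Y j) \<in> curve_points A \<and> Y j \<noteq> 0
      \<and> denominator_order2 (e + 2 * j) (X j / of_nat A)"
    by metis
  have "inj X"
  proof (rule injI)
    fix i j assume "X i = X j"
    then have "e + 2 * i = e + 2 * j"
      using XY denominator_order2_unique by metis
    then show "i = j" by simp
  qed
  moreover have "range X \<subseteq> ?S" using XY by blast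
  ultimately show ?thesis using infinite_iff_countable_subset by blast
qed

lemma infinite_order_curve_group:
  assumes A: "A > 0" and P: "Point x y \<in> curve_points A" "y \<noteq> 0"
  shows "infinite_order (curve_group A) (Point x y)"
  unfolding infinite_order_def
proof (intro allI impI notI)
  fix n :: nat
  assume "n > 0" "Point x y [^]\<^bsub>curve_group A\<^esub> n = \<one>\<^bsub>curve_group A\<^esub>"
  then have "finite (range (\<lambda>k::nat. Point x y [^]\<^bsub>curve_group A\<^esub> k))"
    by (intro finite_range_curve_group_pow) simp_all
  \<comment> \<open>Finitely many multiples have finitely many abscissae; the value 0 at
    \<open>Infinity\<close> is arbitrary.\<close>
  then have "finite ((\<lambda>Q. case Q of Point x' y' \<Rightarrow> x' | Infinity \<Rightarrow> 0) `
      range (\<lambda>k::nat. Point x y [^]\<^bsub>curve_group A\<^esub> k))"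
    by (rule finite_imageI)
  moreover have "{x'. \<exists>y' k. Point x' y' = Point x y [^]\<^bsub>curve_group A\<^esub> (k::nat)
      \<and> Point x' y' \<in> curve_points A \<and> y' \<noteq> 0} \<subseteq> \<dots>"
    by (auto intro!: image_eqI[of _ _ "Point _ _"])
  ultimately show False
    using infinite_pow_abscissae[OF A P] finite_subset by blast
qed

section \<open>Curve points and Pythagorean triples\<close>

text \<open>Inverting the formulas for the triple gives x = A(a + c)/b; then b = 2Ax/y and 2A = ab
  give y = ax.\<close>

lemma curve_point_of_triple:
  fixes a b c :: rat
  assumes "a^2 + b^2 = c^2" "a * b / 2 = of_nat A" "a \<noteq> 0" "b \<noteq> 0"
  obtains x y where "Point x y \<in> curve_points A" "y \<noteq> 0"
proof -
  have nz: "a + c \<noteq> 0"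
  proof
    assume "a + c = 0"
    then have "a^2 = c^2" by algebra
    with assms show False by simp
  qed
  define r where "r = (a + c) / b"
  have "b * r = a + c" using assms by (simp add: r_def)
  define S :: rat where "S = of_nat A"
  have S: "2 * S = a * b" using assms(2) by (simp add: S_def)
  \<comment> \<open>Inserting \<open>c = b * r - a\<close> into the Pythagorean equation leaves a
    factor \<open>b\<close>. The other factor is the curve equation in terms of
    \<open>r\<close>.\<close>
  have "b * (b * r^2 - b - 2 * a * r) = 0"
    using \<open>b * r = a + c\<close> assms(1) by algebra
  then have "b * r^2 - b - 2 * a * r = 0" using assms(4) by simp
  then have "2 * (a * (S * r))^2 = 2 * ((S * r)^3 - S^2 * (S * r))"
    using S by algebra
  then have "Point (S * r) (a * (S * r)) \<in> curve_points A"
    by (simp add: Point_in_curve_iff S_def)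
  moreover have "a * (S * r) \<noteq> 0"
    using S assms(3,4) nz by (auto simp: r_def)
  ultimately show ?thesis by (rule that)
qed

text \<open>These are Euclid's formulas divided by \<open>y\<close>. Half the product of the legs is
  \<open>A * x * (x^2 - A^2) / y^2\<close>, which the curve equation reduces to
  \<open>A\<close>.\<close>

lemma triple_of_curve_point:
  assumes "A > 0" "Point x y \<in> curve_points A" "y \<noteq> 0"
  shows "((x^2 - (of_nat A)^2) / y, 2 * of_nat A * x / y, (x^2 + (of_nat A)^2) / y)
    \<in> pythagorean_triples A"
proof -
  define a :: rat where "a = of_nat A"
  have a: "a > 0" using assms by (simp add: a_def)
  have c: "y^2 = x * (x^2 - a^2)"
    using assms unfolding Point_in_curve_iff a_def by algebra
  then have nz: "x \<noteq> 0" "x^2 - a^2 \<noteq> 0" using assms(3) by auto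
  have pos: "x^2 + a^2 > 0" using a by (simp add: add_nonneg_pos)
  have pyth: "((x^2 - a^2) / y)^2 + (2 * a * x / y)^2 = ((x^2 + a^2) / y)^2"
    by (simp add: power_divide flip: add_divide_distrib) algebra
  have area: "a = \<bar>(x^2 - a^2) / y * (2 * a * x / y) / 2\<bar>"
  proof -
    have "(x^2 - a^2) / y * (2 * a * x / y) / 2 = a * (x * (x^2 - a^2)) / y^2"
      using assms(3) by (simp add: field_simps power2_eq_square)
    then show ?thesis using assms(3) a by (simp flip: c)
  qed
  show ?thesis
    unfolding pythagorean_triples_def a_def[symmetric]
    by (intro CollectI case_prodI conjI)
      (rule pyth area | use a nz pos assms(3) in simp)+
qed

theorem theorem1:
  fixes A :: nat
  assumes "congruent_number A"
  shows "(\<forall>x0 y0 :: rat. Point x0 y0 \<in> carrier (curve_group A) \<and> y0 \<noteq> 0 \<longrightarrow>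
            infinite_order (curve_group A) (Point x0 y0))
       \<and> (pythagorean_triples A \<noteq> {} \<longrightarrow> infinite (pythagorean_triples A))"
proof -
  obtain a b c :: rat where abc: "a^2 + b^2 = c^2" "a * b \<noteq> 0" "a * b / 2 = of_nat A" and A: "A > 0"
    using assms unfolding congruent_number_def by blast
  then obtain x y where P: "Point x y \<in> curve_points A" "y \<noteq> 0"
    using curve_point_of_triple by (metis mult_eq_0_iff)
  let ?S = "{x'. \<exists>y' k. Point x' y' = Point x y [^]\<^bsub>curve_group A\<^esub> (k::nat)
    \<and> Point x' y' \<in> curve_points A \<and> y' \<noteq> 0}"
  let ?g = "\<lambda>(a, b, c). of_nat A * (a + c) / b :: rat"
  \<comment> \<open>\<open>?g\<close> reads the abscissa off the triple, so infinitely many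
    abscissae force infinitely many triples.\<close>
  have "?S \<subseteq> ?g ` pythagorean_triples A"
  proof
    fix x' assume "x' \<in> ?S"
    then obtain y' where P': "Point x' y' \<in> curve_points A" "y' \<noteq> 0" by blast
    then have "x' \<noteq> 0" by (auto simp: Point_in_curve_iff)
    then have "?g ((x'^2 - (of_nat A)^2) / y', 2 * of_nat A * x' / y', (x'^2 + (of_nat A)^2) / y') = x'"
      using A P'(2) by (simp add: power2_eq_square flip: add_divide_distrib)
    then show "x' \<in> ?g ` pythagorean_triples A"
      using triple_of_curve_point[OF A P'] by force
  qed
  then have "infinite (pythagorean_triples A)"
    using infinite_pow_abscissae[OF A P] finite_surj by blast
  then show ?thesis
    using infinite_order_curve_group[OF A] by simp
qed

end
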